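(* Let $n\geq 5$ be an integer such that $4\nmid n$. Then the parameter set $t$-$(v,k,\lambda)$ with $t=4$, $v=\binom{n}{2}+2$, $k=n+1$, $\lambda=2$ is admissible, but there is no block design with these parameters.
   Context: A $t$-$(v,k,\lambda)$ (block) design is a set $D$ of $k$-element subsets (blocks) of a $v$-element set $V$ such that every $t$-element subset of $V$ is contained in exactly $\lambda$ blocks (blocks are not repeated). The parameter set $t$-$(v,k,\lambda)$ is admissible if $\lambda_i=\frac{\binom{v-i}{t-i}}{\binom{k-i}{t-i}}\lambda$ is an integer for all $i\in\{0,\ldots,t\}$. *)

theory Defs
  imports Complex_Main
begin

definition block_design :: "nat \<Rightarrow> nat \<Rightarrow> nat \<Rightarrow> nat \<Rightarrow> 'a set \<Rightarrow> 'a set set \<Rightarrow> bool" where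
  "block_design t v k l V D \<longleftrightarrow>
     finite V \<and> card V = v \<and>
     (\<forall>B\<in>D. B \<subseteq> V \<and> card B = k) \<and>
     (\<forall>T. T \<subseteq> V \<and> card T = t \<longrightarrow> card {B \<in> D. T \<subseteq> B} = l)"

text \<open>Meant for \<open>t \<le> k \<le> v\<close>: then the natural-number subtractions do not truncate and the
  denominator is nonzero. The quotient is taken in the rationals.\<close>

definition design_lambda :: "nat \<Rightarrow> nat \<Rightarrow> nat \<Rightarrow> nat \<Rightarrow> nat \<Rightarrow> rat" where
  "design_lambda t v k l i =
     of_nat ((v - i) choose (t - i)) / of_nat ((k - i) choose (t - i)) * of_nat l"

definition admissible :: "nat \<Rightarrow> nat \<Rightarrow> nat \<Rightarrow> nat \<Rightarrow> bool" where
  "admissible t v k l \<longleftrightarrow> (\<forall>i\<in>{0..t}. design_lambda t v k l i \<in> \<int>)"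

end

theory Submission
  imports Defs
begin

text \<open>The parameters are those of a tight 4-design: the number of blocks is \<open>v choose 2\<close>.
  Fix a block \<open>B\<close>. The sums over all blocks \<open>B'\<close> of \<open>card (B \<inter> B') choose j\<close> are known for
  \<open>j \<le> 4\<close>, so the sum of \<open>q (card (B \<inter> B'))\<^sup>2\<close> is known for every quadratic \<open>q\<close>. For
  \<open>q x = (n - 2) (n + 1) (x - 1) (x - 4) + 8 (n + 1 - x)\<close>, the Delsarte polynomial of the tight
  design, the block \<open>B' = B\<close> already contributes the whole sum, so \<open>q\<close> vanishes at every
  intersection size of distinct blocks. But two distinct blocks share some 4-set, and \<open>q x > 0\<close> for
  \<open>4 \<le> x \<le> n\<close>.\<close>

section \<open>Double counting in designs\<close>

lemma block_design_finite: "block_design t v k l V D \<Longrightarrow> finite D"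
  unfolding block_design_def by (meson Pow_iff finite_Pow_iff finite_subset subsetI)

text \<open>Count the pairs \<open>(x, B)\<close> with \<open>x \<in> V - T\<close> and
  \<open>insert x T \<subseteq> B\<close> in two ways: each \<open>x\<close> lies in
  \<open>l\<close> such pairs, each block through \<open>T\<close> in \<open>k - t\<close>. The
  value \<open>l'\<close> enters through an equation, so no division occurs.\<close>

lemma block_design_reduce:
  assumes D: "block_design (Suc t) v k l V D" and "t < k" and l': "(v - t) * l = (k - t) * l'"
  shows "block_design t v k l' V D"
  unfolding block_design_def
proof (intro conjI allI impI)
  have fV: "finite V" and cV: "card V = v"
    and blk: "\<And>B. B \<in> D \<Longrightarrow> B \<subseteq> V \<and> card B = k"
    and cov: "\<And>T. T \<subseteq> V \<Longrightarrow> card T = Suc t \<Longrightarrow> card {B \<in> D. T \<subseteq> B} = l"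
    using D unfolding block_design_def by auto
  have fD: "finite D" using D by (rule block_design_finite)
  show "finite V" "card V = v" "\<forall>B\<in>D. B \<subseteq> V \<and> card B = k" using fV cV blk by auto
  fix T assume T: "T \<subseteq> V \<and> card T = t"
  then have fT: "finite T" using fV finite_subset by blast
  let ?E = "{B \<in> D. T \<subseteq> B}"
  have "(\<Sum>x\<in>V - T. card {B \<in> ?E. x \<in> B}) = (\<Sum>B\<in>?E. card {x \<in> V - T. x \<in> B})"
    using sum.swap_restrict[of "V - T" ?E "\<lambda>_ _. 1::nat" "\<lambda>x B. x \<in> B"] fV fD by simp
  moreover have "card {B \<in> ?E. x \<in> B} = l" if "x \<in> V - T" for x
  proof -
    have "{B \<in> ?E. x \<in> B} = {B \<in> D. insert x T \<subseteq> B}" by auto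
    then show ?thesis using cov[of "insert x T"] that T fT by simp
  qed
  moreover have "card {x \<in> V - T. x \<in> B} = k - t" if "B \<in> ?E" for B
  proof -
    have "{x \<in> V - T. x \<in> B} = B - T" using blk that by auto
    then show ?thesis using blk that T fT by (simp add: card_Diff_subset)
  qed
  moreover have "card (V - T) = v - t" using T fT cV by (simp add: card_Diff_subset)
  ultimately have "(v - t) * l = (k - t) * card ?E" by (simp add: mult.commute)
  then show "card ?E = l'" using l' \<open>t < k\<close> by simp
qed

text \<open>Both sides count the pairs \<open>(T, B')\<close> with \<open>T\<close> a
  \<open>t\<close>-subset of \<open>B \<inter> B'\<close>. The sum includes the term
  \<open>B' = B\<close>.\<close>

lemma sum_choose_card_Int:
  assumes D: "block_design t v k l V D" and B: "B \<in> D"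
  shows "(\<Sum>B'\<in>D. card (B \<inter> B') choose t) = (k choose t) * l"
proof -
  have fD: "finite D" using D by (rule block_design_finite)
  have BV: "B \<subseteq> V" "card B = k" and fV: "finite V"
    and cov: "\<And>T. T \<subseteq> V \<Longrightarrow> card T = t \<Longrightarrow> card {B \<in> D. T \<subseteq> B} = l"
    using D B unfolding block_design_def by auto
  have fB: "finite B" using BV fV finite_subset by blast
  let ?S = "{T. T \<subseteq> B \<and> card T = t}"
  have fS: "finite ?S" using fB by simp
  have "(\<Sum>T\<in>?S. card {B' \<in> D. T \<subseteq> B'}) = (\<Sum>B'\<in>D. card {T \<in> ?S. T \<subseteq> B'})"
    using sum.swap_restrict[of ?S D "\<lambda>_ _. 1::nat" "\<lambda>T B'. T \<subseteq> B'"] fS fD by simp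
  moreover have "card {T \<in> ?S. T \<subseteq> B'} = card (B \<inter> B') choose t" for B'
  proof -
    have "{T \<in> ?S. T \<subseteq> B'} = {T. T \<subseteq> B \<inter> B' \<and> card T = t}" by auto
    then show ?thesis using n_subsets[of "B \<inter> B'" t] fB by simp
  qed
  moreover have "card {B' \<in> D. T \<subseteq> B'} = l" if "T \<in> ?S" for T
    using that BV by (intro cov) auto
  moreover have "card ?S = k choose t" using n_subsets[OF fB] BV by simp
  ultimately show ?thesis by simp
qed

section \<open>Binomial identities and admissibility\<close>

text \<open>The absorption identity, applied to the numerator and to the denominator, produces the
  common factor \<open>t - i\<close>, which cancels. The recursion starts from
  \<open>\<lambda>\<^sub>t = l\<close> and runs downward.\<close>

lemma design_lambda_step:
  assumes "i < t" "t \<le> k" "t \<le> v"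
  shows "design_lambda t v k l i =
    design_lambda t v k l (Suc i) * of_nat (v - i) / of_nat (k - i)"
proof -
  obtain s where s: "t - i = Suc s" "t - Suc i = s"
    using assms by (metis Suc_diff_Suc)
  obtain a where a: "v - i = Suc a" "v - Suc i = a"
    using assms by (metis Suc_diff_Suc less_le_trans)
  obtain b where b: "k - i = Suc b" "k - Suc i = b"
    using assms by (metis Suc_diff_Suc less_le_trans)
  have "b \<ge> s" using assms s b by linarith
  then have nz: "(of_nat (b choose s) :: rat) \<noteq> 0" "(of_nat (Suc b choose Suc s) :: rat) \<noteq> 0"
    by (simp_all del: binomial_Suc_Suc)
  have absorb: "of_nat (Suc s) * of_nat (Suc c choose Suc s) = (of_nat (Suc c) * of_nat (c choose s) :: rat)"
    for c using Suc_times_binomial[of s c] by (metis of_nat_mult)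
  have quot: "(of_nat (Suc c choose Suc s) :: rat) = of_nat (Suc c) * of_nat (c choose s) / of_nat (Suc s)"
    for c using absorb[of c] by (simp add: field_simps del: binomial_Suc_Suc of_nat_Suc)
  show ?thesis unfolding design_lambda_def s a b quot
    using nz by (simp add: field_simps del: binomial_Suc_Suc of_nat_Suc)
qed

text \<open>Stated for a general field since admissibility works in the rationals and nonexistence
  in the reals.\<close>

lemma choose_234:
  fixes x :: nat
  defines "y \<equiv> (of_nat x :: 'a :: field_char_0)"
  shows "of_nat (x choose 2) = y * (y - 1) / 2"
    and "of_nat (x choose 3) = y * (y - 1) * (y - 2) / 6"
    and "of_nat (x choose 4) = y * (y - 1) * (y - 2) * (y - 3) / 24"
  unfolding y_def binomial_gbinomial gbinomial_prod_rev
  by (simp_all add: eval_nat_numeral fact_numeral)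

lemma two_choose_two: "2 * (n choose 2) + n = n * n"
  by (induction n) (simp_all add: numeral_2_eq_2)

text \<open>This product is \<open>2 * \<lambda>\<^sub>1\<close>, and here \<open>4\<close> not
  dividing \<open>n\<close> enters. For odd \<open>n\<close> the first factor is even; for
  \<open>n = 2 * a\<close> with \<open>a\<close> odd, \<open>n choose 2 = a * (2 * a - 1)\<close> is
  odd.\<close>

lemma even_lambda_1:
  assumes "\<not> 4 dvd n"
  shows "even ((n + 1) * ((n choose 2) + 1))"
proof (cases "even n")
  case True
  then obtain a where a: "n = 2 * a" by blast
  then have "odd a" using assms by auto
  moreover have "(n choose 2) + a = 2 * a * a"
    using two_choose_two[of n] a by simp
  ultimately have "odd (n choose 2)"
    by (metis even_add even_mult_iff dvd_triv_left)
  then show ?thesis by simp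
qed simp

lemma admissible_tight:
  assumes n: "n \<ge> 5" and "\<not> 4 dvd n"
  shows "admissible 4 ((n choose 2) + 2) (n + 1) 2"
proof -
  define m where "m = n choose 2"
  let ?L = "design_lambda 4 (m + 2) (n + 1) 2"
  have m2: "2 * (of_nat m :: rat) = of_nat n * (of_nat n - 1)"
    unfolding m_def choose_234 by simp
  have mn: "2 * m + n = n * n" unfolding m_def by (rule two_choose_two)
  have "5 * n \<le> n * n" using n by simp
  then have m: "m \<ge> 10" using mn n by linarith
  \<comment> \<open>\<open>q\<close> will be \<open>\<lambda>\<^sub>1\<close>.\<close>
  obtain q where q: "(n + 1) * (m + 1) = 2 * q"
    using even_lambda_1[OF assms(2)] unfolding m_def by blast
  have qr: "of_nat q * 2 = ((of_nat n + 1) * (of_nat m + 1) :: rat)"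
    using arg_cong[OF q, of "of_nat :: _ \<Rightarrow> rat"] by (simp add: algebra_simps)
  have step: "?L i = ?L (Suc i) * (of_nat m + 2 - of_nat i) / (of_nat n + 1 - of_nat i)"
    if "i < 4" for i
    using design_lambda_step[of i 4 "n + 1" "m + 2" 2] that n m by (simp add: of_nat_diff add.commute)
  have nn: "(of_nat n :: rat) \<ge> 5" using n by (metis of_nat_le_iff of_nat_numeral)
  have L4: "?L 4 = of_nat 2" by (simp add: design_lambda_def)
  have L3: "?L 3 = of_nat (n + 1)"
  proof -
    have "2 * (of_nat m + 2 - 3) = (of_nat n + 1) * (of_nat n + 1 - 3 :: rat)"
      using m2 by (simp add: algebra_simps)
    then show ?thesis using step[of 3] L4 nn by simp
  qed
  have L2: "?L 2 = of_nat ((n + 1) choose 2)"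
  proof -
    have "2 * ((of_nat n + 1) * of_nat m) = (of_nat n + 1) * of_nat n * (of_nat n + 1 - 2 :: rat)"
      using m2 by algebra
    then show ?thesis using step[of 2] L3 nn by (simp add: choose_234 divide_eq_eq)
  qed
  have L1: "?L 1 = of_nat q"
  proof -
    have "?L 1 = ?L 2 * (of_nat m + 1) / of_nat n"
      using step[of 1] by (simp add: numeral_2_eq_2 add.commute)
    also have "\<dots> = (of_nat n + 1) * of_nat n / 2 * (of_nat m + 1) / of_nat n"
      unfolding L2 choose_234 by simp
    also have "\<dots> = of_nat q" using qr nn by (simp add: divide_eq_eq)
    finally show ?thesis .
  qed
  have L0: "?L 0 = of_nat ((m + 2) choose 2)"
  proof -
    have qr': "of_nat q = ((of_nat n + 1) * (of_nat m + 1) / 2 :: rat)" using qr by simp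
    have "?L 0 = of_nat q * (of_nat m + 2) / (of_nat n + 1)" using step[of 0] L1 by simp
    also have "\<dots> = (of_nat n + 1) * (of_nat m + 1) / 2 * (of_nat m + 2) / (of_nat n + 1)"
      unfolding qr' ..
    also have "\<dots> = (of_nat m + 1) * (of_nat m + 2) / 2"
    proof -
      have "c * a / 2 * b / c = a * b / 2" if "c \<noteq> 0" for a b c :: rat using that by simp
      moreover have "(of_nat n + 1 :: rat) \<noteq> 0" using nn by linarith
      ultimately show ?thesis by blast
    qed
    also have "\<dots> = of_nat ((m + 2) choose 2)" by (simp add: choose_234 algebra_simps)
    finally show ?thesis .
  qed
  have "{0..4} = {0, 1, 2, 3, 4 :: nat}" by auto
  then show ?thesis
    unfolding admissible_def m_def[symmetric] using L0 L1 L2 L3 L4 by (simp del: binomial_Suc_Suc)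
qed

section \<open>Nonexistence by the polynomial argument\<close>

text \<open>Newton's forward difference formula at \<open>0\<close>.\<close>

lemma quadratic_square_newton:
  fixes a b c x :: "'a :: field_char_0"
  defines "f \<equiv> \<lambda>x. (a * x\<^sup>2 + b * x + c)\<^sup>2"
  shows "f x = f 0 + (f 1 - f 0) * x + (f 2 - 2 * f 1 + f 0) * (x * (x - 1) / 2)
    + (f 3 - 3 * f 2 + 3 * f 1 - f 0) * (x * (x - 1) * (x - 2) / 6)
    + (f 4 - 4 * f 3 + 6 * f 2 - 4 * f 1 + f 0) * (x * (x - 1) * (x - 2) * (x - 3) / 24)"
  unfolding f_def by (simp add: field_simps power2_eq_square)

lemma no_tight_block_design:
  assumes n: "n \<ge> 5" and "\<not> 4 dvd n"
  shows "\<not> block_design 4 ((n choose 2) + 2) (n + 1) 2 V D"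
proof
  define m where "m = n choose 2"
  assume "block_design 4 ((n choose 2) + 2) (n + 1) 2 V D"
  then have D4: "block_design 4 (m + 2) (n + 1) 2 V D" by (simp add: m_def)
  have mn: "2 * m + n = n * n" unfolding m_def by (rule two_choose_two)
  \<comment> \<open>Writing \<open>n = p + 5\<close> makes the subtractions on naturals below
    disappear.\<close>
  obtain p where p: "n = p + 5" using n by (metis le_add_diff_inverse2)
  have mp: "2 * m = p * p + 9 * p + 20" using mn unfolding p by (simp add: algebra_simps)
  obtain q where q: "(n + 1) * (m + 1) = 2 * q"
    using even_lambda_1[OF assms(2)] unfolding m_def by blast
  define h where "h = (n + 1) choose 2"
  have h: "2 * h = (n + 1) * n" using two_choose_two[of "n + 1"] by (simp add: h_def)
  \<comment> \<open>Descend through \<open>\<lambda>\<^sub>3 = n + 1\<close>,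
    \<open>\<lambda>\<^sub>2 = h\<close>, \<open>\<lambda>\<^sub>1 = q\<close> to the number of
    blocks. The last three counting equations are doubled because \<open>m\<close>, \<open>h\<close>
    and \<open>q\<close> are known only through their doubles.\<close>
  have D3: "block_design 3 (m + 2) (n + 1) (n + 1) V D"
  proof (rule block_design_reduce)
    show "block_design (Suc 3) (m + 2) (n + 1) 2 V D" using D4 by simp
    show "(m + 2 - 3) * 2 = (n + 1 - 3) * (n + 1)"
      using mp unfolding p by (simp add: algebra_simps)
  qed (use n in simp)
  have D2: "block_design 2 (m + 2) (n + 1) h V D"
  proof (rule block_design_reduce)
    show "block_design (Suc 2) (m + 2) (n + 1) (n + 1) V D" using D3 by simp
    have "2 * (m * (p + 6)) = 2 * ((p + 4) * h)"
      using mp h unfolding p by algebra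
    then show "(m + 2 - 2) * (n + 1) = (n + 1 - 2) * h" unfolding p by (simp add: add.commute)
  qed (use n in simp)
  have D1: "block_design 1 (m + 2) (n + 1) q V D"
  proof (rule block_design_reduce)
    show "block_design (Suc 1) (m + 2) (n + 1) h V D" using D2 by (simp add: numeral_2_eq_2)
    have "2 * ((m + 1) * h) = 2 * (n * q)"
      using q h by (metis mult.assoc mult.commute)
    then show "(m + 2 - 1) * h = (n + 1 - 1) * q" by simp
  qed (use n in simp)
  have D0: "block_design 0 (m + 2) (n + 1) ((m + 2) choose 2) V D"
  proof (rule block_design_reduce)
    show "block_design (Suc 0) (m + 2) (n + 1) q V D" using D1 by simp
    have "2 * ((m + 2) * q) = 2 * ((n + 1) * ((m + 2) choose 2))"
      using q two_choose_two[of "m + 2"] by algebra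
    then show "(m + 2 - 0) * q = (n + 1 - 0) * ((m + 2) choose 2)" by simp
  qed simp

  have fV: "finite V" and cV: "card V = m + 2" and blk: "\<And>B. B \<in> D \<Longrightarrow> B \<subseteq> V \<and> card B = n + 1"
    and cov: "\<And>T. T \<subseteq> V \<Longrightarrow> card T = 4 \<Longrightarrow> card {B \<in> D. T \<subseteq> B} = 2"
    using D4 unfolding block_design_def by auto
  have fD: "finite D" using D4 by (rule block_design_finite)
  \<comment> \<open>Any 4-set will do: as \<open>\<lambda> = 2\<close>, exactly two distinct blocks
    contain it.\<close>
  obtain T where T: "T \<subseteq> V" "card T = 4"
    using obtain_subset_with_card_n[of 4 V] cV mp by auto
  obtain B C where BC: "{B \<in> D. T \<subseteq> B} = {B, C}" "B \<noteq> C"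
    using cov[OF T] by (auto simp: card_2_iff)
  then have B: "B \<in> D" "T \<subseteq> B" and C: "C \<in> D" "T \<subseteq> C" by blast+
  have fB: "finite B" "finite C" using blk[OF B(1)] blk[OF C(1)] fV by (auto intro: finite_subset)

  define r :: real where "r = of_nat n"
  define s :: "'a set \<Rightarrow> real" where "s B' = of_nat (card (B \<inter> B'))" for B'
  \<comment> \<open>\<open>f\<close> is the square of the polynomial
    \<open>A * (x - 1) * (x - 4) + 8 * (r + 1 - x)\<close>, expanded to fit
    \<open>quadratic_square_newton\<close>. That polynomial is not the number \<open>q\<close> of
    this proof, which is \<open>\<lambda>\<^sub>1\<close>.\<close>
  define A where "A = (r - 2) * (r + 1)"
  define f where "f x = (A * x\<^sup>2 + (- 5 * A - 8) * x + (4 * A + 8 * (r + 1)))\<^sup>2" for x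
  have mr: "real m = r * (r - 1) / 2" unfolding m_def r_def by (rule choose_234)
  have qr: "real q = (r + 1) * (real m + 1) / 2"
    using arg_cong[OF q, of real] by (simp add: r_def algebra_simps)
  have hr: "real h = (r + 1) * r / 2"
    unfolding h_def choose_234 by (simp add: r_def)
  have n1: "real (Suc n) = r + 1" by (simp add: r_def)
  have S0: "(\<Sum>B'\<in>D. 1) = (real m + 2) * (real m + 1) / 2"
    using arg_cong[OF sum_choose_card_Int[OF D0 B(1)], of real]
    by (simp add: choose_234 algebra_simps)
  have S1: "(\<Sum>B'\<in>D. s B') = (r + 1) * real q"
    using arg_cong[OF sum_choose_card_Int[OF D1 B(1)], of real]
    by (simp add: s_def n1 del: of_nat_Suc mult_Suc)
  have S2: "(\<Sum>B'\<in>D. s B' * (s B' - 1) / 2) = (r + 1) * r / 2 * real h"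
    using arg_cong[OF sum_choose_card_Int[OF D2 B(1)], of real]
    by (simp add: choose_234 s_def n1 del: of_nat_Suc mult_Suc mult_Suc_right)
  have S3: "(\<Sum>B'\<in>D. s B' * (s B' - 1) * (s B' - 2) / 6) = (r + 1) * r * (r - 1) / 6 * (r + 1)"
    using arg_cong[OF sum_choose_card_Int[OF D3 B(1)], of real]
    by (simp add: choose_234 s_def n1 del: of_nat_Suc mult_Suc mult_Suc_right)
  have S4: "(\<Sum>B'\<in>D. s B' * (s B' - 1) * (s B' - 2) * (s B' - 3) / 24)
      = (r + 1) * r * (r - 1) * (r - 2) / 24 * 2"
    using arg_cong[OF sum_choose_card_Int[OF D4 B(1)], of real]
    by (simp add: choose_234 s_def n1 del: of_nat_Suc mult_Suc mult_Suc_right)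
  \<comment> \<open>Expanding \<open>f\<close> in the binomial basis reduces the sum to
    \<open>S0\<close> to \<open>S4\<close>.\<close>
  have "(\<Sum>B'\<in>D. f (s B')) = f 0 * (\<Sum>B'\<in>D. 1) + (f 1 - f 0) * (\<Sum>B'\<in>D. s B')
      + (f 2 - 2 * f 1 + f 0) * (\<Sum>B'\<in>D. s B' * (s B' - 1) / 2)
      + (f 3 - 3 * f 2 + 3 * f 1 - f 0) * (\<Sum>B'\<in>D. s B' * (s B' - 1) * (s B' - 2) / 6)
      + (f 4 - 4 * f 3 + 6 * f 2 - 4 * f 1 + f 0)
        * (\<Sum>B'\<in>D. s B' * (s B' - 1) * (s B' - 2) * (s B' - 3) / 24)"
    unfolding sum_distrib_left sum.distrib[symmetric]
    by (rule sum.cong[OF refl], unfold mult_1_right, unfold f_def) (rule quadratic_square_newton)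
  also have "\<dots> = f (r + 1)"
  proof -
    \<comment> \<open>The factored values keep the final identity, a polynomial identity in
      \<open>r\<close>, manageable.\<close>
    have f: "f 0 = (4 * r * (r + 1))\<^sup>2" "f 1 = (8 * r)\<^sup>2" "f 2 = (2 * (r\<^sup>2 - 5 * r + 2))\<^sup>2"
      "f 3 = (2 * (r - 2) * (r - 3))\<^sup>2" "f 4 = (8 * (r - 3))\<^sup>2"
      "f (r + 1) = ((r - 2) * (r + 1) * r * (r - 3))\<^sup>2"
      unfolding f_def A_def by (simp_all add: algebra_simps power2_eq_square)
    show ?thesis
      unfolding f S0 S1 S2 S3 S4 qr hr mr
      by (simp add: field_simps power2_eq_square)
  qed
  \<comment> \<open>The total is thus exactly the term of \<open>B\<close>; the remaining terms are
    squares with sum zero.\<close>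
  also have "r + 1 = s B" using B blk by (simp add: s_def r_def)
  finally have "(\<Sum>B'\<in>D - {B}. f (s B')) = 0"
    using sum.remove[OF fD B(1), of "\<lambda>B'. f (s B')"] by simp
  then have "f (s C) = 0"
    using sum_nonneg_eq_0_iff[of "D - {B}" "\<lambda>B'. f (s B')"] fD C BC(2) by (auto simp: f_def)
  then have "A * (s C)\<^sup>2 + (- 5 * A - 8) * s C + (4 * A + 8 * (r + 1)) = 0"
    unfolding f_def by simp
  then have root: "A * (s C - 1) * (s C - 4) + 8 * (r + 1 - s C) = 0"
    by (simp add: algebra_simps power2_eq_square)
  have "4 \<le> card (B \<inter> C)"
    using card_mono[of "B \<inter> C" T] fB B C T by simp
  moreover have "card (B \<inter> C) < n + 1"
  proof -
    \<comment> \<open>Blocks have equal size, so inclusion would force \<open>B = C\<close>.\<close>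
    have "\<not> B \<subseteq> C" using card_subset_eq[OF fB(2)] BC(2) B C blk by metis
    then have "B \<inter> C \<subset> B" by blast
    then show ?thesis using psubset_card_mono[OF fB(1)] B blk by metis
  qed
  ultimately have "4 \<le> s C" "s C < r + 1" by (simp_all add: s_def r_def)
  \<comment> \<open>The first summand is then nonnegative, and \<open>s C < r + 1\<close> makes the
    second one positive.\<close>
  moreover have "A \<ge> 0" using n by (simp add: A_def r_def)
  ultimately have "A * (s C - 1) * (s C - 4) + 8 * (r + 1 - s C) > 0"
    by (intro add_nonneg_pos mult_nonneg_nonneg) auto
  with root show False by simp
qed

theorem theorem3p3:
  fixes n :: nat
  assumes "n \<ge> 5" and "\<not> 4 dvd n"
  shows "admissible 4 ((n choose 2) + 2) (n + 1) 2 \<and>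
    \<not> (\<exists>(V :: 'a set) (D :: 'a set set). block_design 4 ((n choose 2) + 2) (n + 1) 2 V D)"
  using admissible_tight[OF assms] no_tight_block_design[OF assms] by blast

end
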